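(* Let $a<b$ be real numbers and let $p:[a,b]\to[1,+\infty)$ be Lebesgue integrable. Suppose there exists a point $x\in(a,b)$ such that $$\bar p_-^x(a;b)<\max\{\bar p_-^x(a;x),\ \bar p_-^x(x;b)\}.$$ Then for any number $C\ge 1$ there exists a function $f=f_C\in WBV_{p(\cdot)}[a,b]$ such that $$V_a^b(p,f)>C\cdot\left(V_a^x(p,f)+V_x^b(p,f)\right).$$
   Context: For a nondegenerate closed interval $Q=[s,t]\subset[a,b]$ put $f(Q):=f(t)-f(s)$, $|Q|=t-s$, and $\bar p(Q):=\left(\frac{1}{|Q|}\int_Q\frac{1}{p(y)}\,dy\right)^{-1}$. For $a\le\alpha<\beta\le b$, a finite partition of $[\alpha,\beta]$ is a family $P=\{Q_k\}_{k=1}^n$ with $Q_k=[t_{k-1},t_k]$ and $\alpha=t_0<\dots<t_n=\beta$; $\Pi[\alpha,\beta]$ is the set of all finite partitions of $[\alpha,\beta]$. Define $$V_\alpha^\beta(p,f):=\sup_{P\in\Pi[\alpha,\beta]}\sum_{k=1}^n|f(Q_k)|^{\bar p(Q_k)}\in[0,+\infty],$$ $$\|f\|_{WBV_{p(\cdot)}}:=\inf\{\lambda>0: V_a^b(p,f/\lambda)\le 1\}\quad(\inf\emptyset=+\infty),$$ $$WBV_{p(\cdot)}[a,b]:=\{f:[a,b]\to\mathbb{R}: f(a)=0,\ \|f\|_{WBV_{p(\cdot)}}<+\infty\}.$$ For $a\le\alpha<\beta\le b$ and $x\in[\alpha,\beta]$ set $$\bar p_-^x(\alpha;\beta):=\inf\{\bar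 p([c,d]) : x\in[c,d]\subset[\alpha,\beta],\ c<d\}.$$ *)

theory Defs
  imports "HOL-Analysis.Analysis"
begin

text \<open>
  A function on \<open>[a,b]\<close> is a total function on the reals of which only the values on
  \<open>{a..b}\<close> matter. An interval \<open>Q = [s,t]\<close> is given by its endpoints, so that \<open>f(Q)\<close> is
  \<open>f t - f s\<close>. All definitions are meant for \<open>s < t\<close>, \<open>\<alpha> < \<beta>\<close> and \<open>a < b\<close>.
\<close>

definition pbar :: "(real \<Rightarrow> real) \<Rightarrow> real \<Rightarrow> real \<Rightarrow> real" where
  "pbar p s t = inverse (1 / (t - s) * (LINT y:{s..t}|lebesgue. 1 / p y))"

text \<open>
  The pair \<open>(n, t)\<close> stands for the partition \<open>\<alpha> = t 0 < \<dots> < t n = \<beta>\<close>; the values of \<open>t\<close>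
  beyond \<open>n\<close> are irrelevant.
\<close>

definition partitions :: "real \<Rightarrow> real \<Rightarrow> (nat \<times> (nat \<Rightarrow> real)) set" where
  "partitions \<alpha> \<beta> = {(n, t). t 0 = \<alpha> \<and> t n = \<beta> \<and> strict_mono_on {..n} t}"

definition Var :: "(real \<Rightarrow> real) \<Rightarrow> (real \<Rightarrow> real) \<Rightarrow> real \<Rightarrow> real \<Rightarrow> ennreal" where
  "Var p f \<alpha> \<beta> =
    (SUP (n, t)\<in>partitions \<alpha> \<beta>.
       ennreal (\<Sum>k=1..n. \<bar>f (t k) - f (t (k - 1))\<bar> powr pbar p (t (k - 1)) (t k)))"

text \<open>The infimum is taken in \<^typ>\<open>ennreal\<close>, where the infimum of the empty set is \<open>\<infinity>\<close>.\<close>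

definition WBV_norm :: "(real \<Rightarrow> real) \<Rightarrow> real \<Rightarrow> real \<Rightarrow> (real \<Rightarrow> real) \<Rightarrow> ennreal" where
  "WBV_norm p a b f = (INF l\<in>{l::real. 0 < l \<and> Var p (\<lambda>y. f y / l) a b \<le> 1}. ennreal l)"

definition WBV :: "(real \<Rightarrow> real) \<Rightarrow> real \<Rightarrow> real \<Rightarrow> (real \<Rightarrow> real) set" where
  "WBV p a b = {f. f a = 0 \<and> WBV_norm p a b f < \<infinity>}"

text \<open>
  For \<open>p \<ge> 1\<close> and \<open>x \<in> [\<alpha>,\<beta>]\<close> the set below is nonempty and bounded below by \<open>1\<close>, so
  the real infimum is the intended one.
\<close>

definition pbar_inf :: "(real \<Rightarrow> real) \<Rightarrow> real \<Rightarrow> real \<Rightarrow> real \<Rightarrow> real" where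
  "pbar_inf p x \<alpha> \<beta> =
    Inf {pbar p c d | c d. c < d \<and> x \<in> {c..d} \<and> {c..d} \<subseteq> {\<alpha>..\<beta>}}"

end

theory Submission
  imports Defs
begin

text \<open>
  A single jump at \<open>x\<close> is enough. Write \<open>M\<close> for the larger of the two one-sided infima. If
  it belongs to \<open>[a,x]\<close>, let \<open>f\<close> jump from \<open>0\<close> to a small height \<open>h \<le> 1\<close> on reaching \<open>x\<close>;
  otherwise let it jump immediately after \<open>x\<close>. In either case \<open>f\<close> is constant on one of
  \<open>[a,x]\<close>, \<open>[x,b]\<close>, and on the other one every interval that sees the jump has \<open>x\<close> as an
  endpoint, hence exponent at least \<open>M\<close>. A partition has at most one interval that sees the
  jump, so both one-sided variations are at most \<open>h powr M\<close> (\<open>Var_step_le\<close>).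

  On the whole of \<open>[a,b]\<close>, however, some interval around \<open>x\<close> has an exponent \<open>q < M\<close>. This
  interval may have \<open>x\<close> as an endpoint and so fail to see the jump, but \<open>pbar p\<close> is continuous in
  the endpoints, so it can be replaced by one with \<open>x\<close> in its interior
  (\<open>pbar_less_strictly_inside\<close>). Thus the variation over \<open>[a,b]\<close> is at least \<open>h powr q\<close>,
  and its ratio to the sum of the others is at least \<open>h powr (q - M) / 2\<close>, which tends to
  infinity as \<open>h\<close> tends to \<open>0\<close> (\<open>ex_step_Var_gt\<close>).
\<close>

section \<open>The variation of a step function\<close>

text \<open>
  The set \<open>U\<close> will be a ray \<open>{x..}\<close> or \<open>{x<..}\<close>. Arguing with upward closed sets treats both
  kinds of jump at once, including those that lie at an end of the interval considered.
\<close>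

definition step :: "real set \<Rightarrow> real \<Rightarrow> real \<Rightarrow> real" where
  "step U h y = (if y \<in> U then h else 0)"

text \<open>
  In any partition at most one interval leads from outside \<open>U\<close> into \<open>U\<close>, so only one summand is
  nonzero. In particular the bound \<open>B = 0\<close> is admissible when no such interval exists.
\<close>

lemma Var_step_le:
  assumes up: "\<And>u v. u \<in> U \<Longrightarrow> u \<le> v \<Longrightarrow> v \<in> U"
    and "0 < h" "0 \<le> B"
    and bound: "\<And>c d. \<lbrakk>\<alpha> \<le> c; c < d; d \<le> \<beta>; c \<notin> U; d \<in> U\<rbrakk> \<Longrightarrow> h powr pbar p c d \<le> B"
  shows "Var p (step U h) \<alpha> \<beta> \<le> ennreal B"
  unfolding Var_def
proof (rule SUP_least, clarify)
  fix n :: nat and t :: "nat \<Rightarrow> real"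
  assume "(n, t) \<in> partitions \<alpha> \<beta>"
  then have t0: "t 0 = \<alpha>" and tn: "t n = \<beta>" and mono: "strict_mono_on {..n} t"
    by (auto simp: partitions_def)
  have less: "t i < t j" if "i < j" "j \<le> n" for i j
    using strict_mono_onD[OF mono, of i j] that by auto
  have le: "t i \<le> t j" if "i \<le> j" "j \<le> n" for i j
    using less[of i j] that by (cases "i = j") auto
  define g where "g k = \<bar>step U h (t k) - step U h (t (k - 1))\<bar> powr pbar p (t (k - 1)) (t k)" for k
  define J where "J = {k \<in> {1..n}. t (k - 1) \<notin> U \<and> t k \<in> U}"
  have outside: "g k = 0" if "k \<in> {1..n} - J" for k
  proof -
    have "t (k - 1) \<in> U \<longleftrightarrow> t k \<in> U"
      using that up[of "t (k - 1)" "t k"] le[of "k - 1" k] by (auto simp: J_def)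
    then show ?thesis by (simp add: g_def step_def)
  qed
  have unique: "k = l" if "k \<in> J" "l \<in> J" for k l
  proof -
    have "\<not> i < j" if "i \<in> J" "j \<in> J" for i j
      using that up[of "t i" "t (j - 1)"] le[of i "j - 1"] by (auto simp: J_def)
    then show ?thesis using that by (meson linorder_neqE_nat)
  qed
  have "sum g {1..n} = sum g J"
    by (rule sum.mono_neutral_right) (use outside in \<open>auto simp: J_def\<close>)
  also have "\<dots> \<le> B"
  proof (cases "J = {}")
    case False
    then obtain k where k: "k \<in> J" by blast
    then have "J = {k}" using unique by blast
    moreover have "g k \<le> B"
      using k bound[of "t (k - 1)" "t k"] less[of "k - 1" k] le[of 0 "k - 1"] le[of k n] \<open>0 < h\<close>
      by (auto simp: J_def g_def step_def t0 tn)
    ultimately show ?thesis by simp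
  qed (use \<open>0 \<le> B\<close> in simp)
  finally show "ennreal (\<Sum>k = 1..n. \<bar>step U h (t k) - step U h (t (k - 1))\<bar>
      powr pbar p (t (k - 1)) (t k)) \<le> ennreal B"
    unfolding g_def by (rule ennreal_leI)
qed

lemma strict_mono_on_atMost_SucI:
  fixes t :: "nat \<Rightarrow> 'a::order"
  assumes "\<And>i. i < n \<Longrightarrow> t i < t (Suc i)"
  shows "strict_mono_on {..n} t"
proof (rule strict_mono_onI)
  fix i j assume "i \<in> {..n}" "j \<in> {..n}" "i < j"
  then show "t i < t j"
  proof (induction j)
    case (Suc j)
    then have "t j < t (Suc j)" by (intro assms) auto
    then show ?case using Suc by (cases "i = j") (auto intro: less_trans)
  qed simp
qed

text \<open>
  The witness is the partition with the nodes \<open>\<alpha>\<close>, \<open>c\<close>, \<open>d\<close>, \<open>\<beta>\<close>; the strict inequalities keep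
  it from degenerating.
\<close>

lemma powr_pbar_le_Var:
  assumes "\<alpha> < c" "c < d" "d < \<beta>"
  shows "ennreal (\<bar>f d - f c\<bar> powr pbar p c d) \<le> Var p f \<alpha> \<beta>"
proof -
  define t :: "nat \<Rightarrow> real" where "t = (!) [\<alpha>, c, d, \<beta>]"
  define g where "g k = \<bar>f (t k) - f (t (k - 1))\<bar> powr pbar p (t (k - 1)) (t k)" for k
  have "strict_mono_on {..3} t"
    by (rule strict_mono_on_atMost_SucI)
      (use assms in \<open>auto simp: t_def numeral_3_eq_3 less_Suc_eq\<close>)
  then have mem: "(3, t) \<in> partitions \<alpha> \<beta>"
    by (simp add: partitions_def t_def)
  have "g 2 \<le> sum g {1..3}"
    by (rule member_le_sum) (auto simp: g_def)
  then have "\<bar>f d - f c\<bar> powr pbar p c d \<le> sum g {1..3}"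
    by (simp add: g_def t_def)
  then have "ennreal (\<bar>f d - f c\<bar> powr pbar p c d) \<le> ennreal (sum g {1..3})"
    by (rule ennreal_leI)
  also have "\<dots> \<le> Var p f \<alpha> \<beta>"
    unfolding Var_def by (rule SUP_upper2[OF mem]) (simp add: g_def)
  finally show ?thesis .
qed

text \<open>
  Dividing by the height gives a jump of size \<open>1\<close>, and \<open>1\<close> to any power is \<open>1\<close>: the norm is at
  most \<open>h\<close>, whatever the exponents are.
\<close>

lemma step_in_WBV:
  assumes up: "\<And>u v. u \<in> U \<Longrightarrow> u \<le> v \<Longrightarrow> v \<in> U"
    and "a \<notin> U" "0 < h"
  shows "step U h \<in> WBV p a b"
proof -
  have "(\<lambda>y. step U h y / h) = step U 1"
    using \<open>0 < h\<close> by (auto simp: step_def)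
  moreover have "Var p (step U 1) a b \<le> ennreal 1"
    by (rule Var_step_le[OF up]) auto
  ultimately have "WBV_norm p a b (step U h) \<le> ennreal h"
    unfolding WBV_norm_def using \<open>0 < h\<close> by (intro INF_lower) simp
  then have "WBV_norm p a b (step U h) < \<infinity>"
    by (rule order.strict_trans1) simp
  then show ?thesis
    using \<open>a \<notin> U\<close> by (simp add: WBV_def step_def)
qed

text \<open>
  Since \<open>q < M\<close>, the power \<open>h powr M\<close> is negligible against \<open>h powr q\<close> for small \<open>h\<close>. The
  assumptions on the two sides hold vacuously on a side where the step function is constant.
\<close>

lemma ex_step_Var_gt:
  assumes up: "\<And>u v. u \<in> U \<Longrightarrow> u \<le> v \<Longrightarrow> v \<in> U"
    and "a \<notin> U" "a < c" "c < d" "d < b" "c \<notin> U" "d \<in> U"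
    and less: "pbar p c d < M"
    and left: "\<And>s t. \<lbrakk>a \<le> s; s < t; t \<le> x; s \<notin> U; t \<in> U\<rbrakk> \<Longrightarrow> M \<le> pbar p s t"
    and right: "\<And>s t. \<lbrakk>x \<le> s; s < t; t \<le> b; s \<notin> U; t \<in> U\<rbrakk> \<Longrightarrow> M \<le> pbar p s t"
    and "1 \<le> C"
  shows "\<exists>f\<in>WBV p a b. Var p f a b > ennreal C * (Var p f a x + Var p f x b)"
proof -
  define q where "q = pbar p c d"
  \<comment> \<open>Solves \<open>h powr (M - q) = 1 / (4 * C)\<close>; the \<open>4\<close> covers the two one-sided variations and
    makes the final inequality strict.\<close>
  define h where "h = (1 / (4 * C)) powr (1 / (M - q))"
  have "q < M" using less by (simp add: q_def)
  have h: "0 < h" "h \<le> 1"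
    using \<open>1 \<le> C\<close> \<open>q < M\<close> by (auto simp: h_def intro!: powr_le1)
  have "h powr (M - q) = 1 / (4 * C)"
    using \<open>q < M\<close> \<open>1 \<le> C\<close> by (simp add: h_def powr_powr)
  then have hM: "h powr M = h powr q / (4 * C)"
    using powr_add[of h q "M - q"] by simp
  have sides: "Var p (step U h) a x \<le> ennreal (h powr M)" "Var p (step U h) x b \<le> ennreal (h powr M)"
    by (rule Var_step_le[OF up]; use h left right in \<open>auto intro!: powr_mono'\<close>)+
  have "ennreal C * (Var p (step U h) a x + Var p (step U h) x b)
      \<le> ennreal C * (ennreal (h powr M) + ennreal (h powr M))"
    by (intro mult_left_mono add_mono sides) simp
  also have "\<dots> = ennreal (C * (h powr M + h powr M))"
    using \<open>1 \<le> C\<close> by (simp flip: ennreal_plus ennreal_mult)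
  also have "\<dots> = ennreal (h powr q / 2)"
    using \<open>1 \<le> C\<close> by (simp add: hM field_simps)
  also have "\<dots> < ennreal (h powr q)"
    using h by (intro ennreal_lessI) auto
  also have "\<dots> \<le> Var p (step U h) a b"
    using powr_pbar_le_Var[OF \<open>a < c\<close> \<open>c < d\<close> \<open>d < b\<close>, of "step U h" p] assms(6,7) h
    by (simp add: step_def q_def)
  finally have "ennreal C * (Var p (step U h) a x + Var p (step U h) x b) < Var p (step U h) a b" .
  moreover have "step U h \<in> WBV p a b"
    by (rule step_in_WBV) (use up \<open>a \<notin> U\<close> h in blast)+
  ultimately show ?thesis
    by blast
qed

section \<open>The averaged exponent as a function of the interval\<close>

context
  fixes a b :: real and p :: "real \<Rightarrow> real"
  assumes p_ge_1: "\<And>y. y \<in> {a..b} \<Longrightarrow> 1 \<le> p y"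
    and p_int: "set_integrable lebesgue {a..b} p"
begin

lemma set_integrable_reciprocal: "set_integrable lebesgue {a..b} (\<lambda>y. 1 / p y)"
proof -
  have "(\<lambda>y. indicator {a..b} y *\<^sub>R p y) \<in> borel_measurable lebesgue"
    using p_int by (auto simp: set_integrable_def)
  then have "(\<lambda>y. inverse (indicator {a..b} y *\<^sub>R p y)) \<in> borel_measurable lebesgue"
    by (rule borel_measurable_inverse)
  \<comment> \<open>Off \<open>{a..b}\<close> this relies on \<open>inverse 0 = 0\<close>.\<close>
  moreover have "inverse (indicator {a..b} y *\<^sub>R p y) = indicator {a..b} y *\<^sub>R (1 / p y)" for y
    by (auto simp: indicator_def inverse_eq_divide)
  ultimately have meas: "(\<lambda>y. indicator {a..b} y *\<^sub>R (1 / p y)) \<in> borel_measurable lebesgue"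
    by simp
  show ?thesis
    unfolding set_integrable_def
  proof (rule Bochner_Integration.integrable_bound[OF p_int[unfolded set_integrable_def] meas])
    show "AE y in lebesgue. norm (indicator {a..b} y *\<^sub>R (1 / p y))
        \<le> norm (indicator {a..b} y *\<^sub>R p y)"
    proof (rule AE_I2)
      fix y
      show "norm (indicator {a..b} y *\<^sub>R (1 / p y)) \<le> norm (indicator {a..b} y *\<^sub>R p y)"
        using p_ge_1[of y] order_trans[of "1 / p y" 1 "p y"] by (auto simp: indicator_def)
    qed
  qed
qed

lemma set_integrable_reciprocal_sub:
  assumes "a \<le> c" "d \<le> b"
  shows "set_integrable lebesgue {c..d} (\<lambda>y. 1 / p y)"
  by (rule set_integrable_subset[OF set_integrable_reciprocal]) (use assms in auto)

text \<open>
  Strict positivity is what makes \<open>pbar p\<close> continuous, since its definition inverts this integral.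
  There is no uniform lower bound for \<open>1 / p\<close> because \<open>p\<close> may be unbounded; instead, a vanishing
  integral would force the positive function \<open>1 / p\<close> to vanish almost everywhere on \<open>{c..d}\<close>.
\<close>

lemma reciprocal_integral_pos:
  assumes "a \<le> c" "c < d" "d \<le> b"
  shows "0 < (LINT y:{c..d}|lebesgue. 1 / p y)"
proof (rule ccontr)
  let ?g = "\<lambda>y. indicator {c..d} y *\<^sub>R (1 / p y)"
  have pos: "0 < 1 / p y" if "y \<in> {c..d}" for y
    using p_ge_1[of y] that assms by auto
  have nonneg: "0 \<le> ?g y" for y
    using pos[of y] by (auto simp: indicator_def)
  assume "\<not> ?thesis"
  then have "integral\<^sup>L lebesgue ?g = 0"
    using nonneg by (intro antisym integral_nonneg_AE) (auto simp: set_lebesgue_integral_def)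
  then have "AE y in lebesgue. ?g y = 0"
    using integral_nonneg_eq_0_iff_AE[of lebesgue ?g] nonneg
      set_integrable_reciprocal_sub[OF assms(1,3)] by (simp add: set_integrable_def)
  then have "AE y in lebesgue. y \<notin> {c..d}"
    by eventually_elim (use pos in \<open>force simp: indicator_def\<close>)
  then have "emeasure lebesgue {c..d} = 0"
    by (subst (asm) AE_iff_measurable[of "{c..d}"]) auto
  then show False using assms by simp
qed

lemma reciprocal_integral_eq_diff:
  assumes "a \<le> c" "c \<le> d" "d \<le> b"
  shows "(LINT y:{c..d}|lebesgue. 1 / p y)
    = integral {a..d} (\<lambda>y. 1 / p y) - integral {a..c} (\<lambda>y. 1 / p y)"
proof -
  have "(LINT y:{c..d}|lebesgue. 1 / p y) = integral {c..d} (\<lambda>y. 1 / p y)"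
    using assms by (intro set_lebesgue_integral_eq_integral(2) set_integrable_reciprocal_sub)
  moreover have "integral {a..c} (\<lambda>y. 1 / p y) + integral {c..d} (\<lambda>y. 1 / p y)
      = integral {a..d} (\<lambda>y. 1 / p y)"
    using assms
    by (intro Henstock_Kurzweil_Integration.integral_combine
        set_lebesgue_integral_eq_integral(1) set_integrable_reciprocal_sub) auto
  ultimately show ?thesis by simp
qed

text \<open>
  Both endpoints are moved linearly towards points strictly between \<open>a\<close> and \<open>x\<close>, respectively
  \<open>x\<close> and \<open>b\<close>. As soon as the parameter is positive, the interval has \<open>x\<close> in its interior and
  stays away from \<open>a\<close> and \<open>b\<close>; for a small parameter its exponent is still below \<open>K\<close>.
\<close>

lemma pbar_less_strictly_inside:
  assumes "a \<le> c" "c < d" "d \<le> b" "x \<in> {c..d}" "x \<in> {a<..<b}" and less: "pbar p c d < K"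
  obtains c' d' where "a < c'" "c' < x" "x < d'" "d' < b" "pbar p c' d' < K"
proof -
  define F where "F = (\<lambda>u. integral {a..u} (\<lambda>y. 1 / p y))"
  obtain c1 d1 where c1: "a < c1" "c1 < x" and d1: "x < d1" "d1 < b"
    using dense[of a x] dense[of x b] \<open>x \<in> {a<..<b}\<close> by auto
  define l where "l s = (1 - s) * c + s * c1" for s
  define r where "r s = (1 - s) * d + s * d1" for s
  have inside: "a < l s \<and> l s < x \<and> x < r s \<and> r s < b" if "0 < s" "s \<le> 1" for s
  proof -
    have 1: "0 < s * (x - c1)" "0 < s * (c1 - a)" "0 < s * (b - d1)" "0 < s * (d1 - x)"
      using that c1 d1 by auto
    have 2: "0 \<le> (1 - s) * (x - c)" "0 \<le> (1 - s) * (c - a)"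
      "0 \<le> (1 - s) * (b - d)" "0 \<le> (1 - s) * (d - x)"
      using that assms by auto
    show ?thesis
      using add_pos_nonneg[OF 1(1) 2(1)] add_pos_nonneg[OF 1(2) 2(2)]
        add_pos_nonneg[OF 1(3) 2(3)] add_pos_nonneg[OF 1(4) 2(4)]
      unfolding l_def r_def by (simp add: algebra_simps)
  qed
  have bounds: "a \<le> l s \<and> l s < r s \<and> r s \<le> b" if "s \<in> {0..1}" for s
    using inside[of s] that assms by (cases "s = 0") (auto simp: l_def r_def)
  have pbar_eq: "pbar p (l s) (r s) = inverse (1 / (r s - l s) * (F (r s) - F (l s)))"
    and F_less: "F (l s) < F (r s)" if "s \<in> {0..1}" for s
    using reciprocal_integral_eq_diff[of "l s" "r s"] reciprocal_integral_pos[of "l s" "r s"]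
      bounds[OF that] by (auto simp: pbar_def F_def)
  have ne: "r s - l s \<noteq> 0" "1 / (r s - l s) * (F (r s) - F (l s)) \<noteq> 0" if "s \<in> {0..1}" for s
    using bounds[OF that] F_less[OF that] by auto
  have contF: "continuous_on {a..b} F"
    unfolding F_def
    by (rule indefinite_integral_continuous_1
        [OF set_lebesgue_integral_eq_integral(1)[OF set_integrable_reciprocal]])
  have contl: "continuous_on {0..1} l" and contr: "continuous_on {0..1} r"
    unfolding l_def r_def by (intro continuous_intros; simp)+
  have "continuous_on {0..1} (\<lambda>s. F (l s))" "continuous_on {0..1} (\<lambda>s. F (r s))"
    by (rule continuous_on_compose2[OF contF contl], use bounds in force)
      (rule continuous_on_compose2[OF contF contr], use bounds in force)
  then have "continuous_on {0..1} (\<lambda>s. inverse (1 / (r s - l s) * (F (r s) - F (l s))))"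
    by (intro continuous_intros contl contr ballI ne)
  then have "continuous_on {0..1} (\<lambda>s. pbar p (l s) (r s))"
    by (rule continuous_on_eq) (simp add: pbar_eq)
  then have "((\<lambda>s. pbar p (l s) (r s)) \<longlongrightarrow> pbar p (l 0) (r 0)) (at_right 0)"
    by (auto dest: continuous_on_Icc_at_rightD)
  moreover have "pbar p (l 0) (r 0) < K"
    using less by (simp add: l_def r_def)
  ultimately have "\<forall>\<^sub>F s in at_right 0. pbar p (l s) (r s) < K"
    by (rule order_tendstoD)
  moreover have "\<forall>\<^sub>F s in at_right 0. s \<in> {0<..<1::real}"
    by (rule eventually_at_right_real) simp
  ultimately have "\<forall>\<^sub>F s in at_right 0. pbar p (l s) (r s) < K \<and> s \<in> {0<..<1}"
    by (rule eventually_conj)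
  then obtain s where "pbar p (l s) (r s) < K" "0 < s" "s < 1"
    using eventually_happens'[OF trivial_limit_at_right_real] by force
  then show ?thesis
    using inside[of s] that by auto
qed

lemma pbar_inf_le:
  assumes "a \<le> \<alpha>" "\<alpha> \<le> c" "c < d" "d \<le> \<beta>" "\<beta> \<le> b" "x \<in> {c..d}"
  shows "pbar_inf p x \<alpha> \<beta> \<le> pbar p c d"
  unfolding pbar_inf_def
proof (rule cInf_lower)
  show "bdd_below {pbar p c d | c d. c < d \<and> x \<in> {c..d} \<and> {c..d} \<subseteq> {\<alpha>..\<beta>}}"
  proof (rule bdd_belowI[of _ 0], clarify)
    fix c d assume "c < d" "{c..d} \<subseteq> {\<alpha>..\<beta>}"
    then have "a \<le> c" "d \<le> b" using assms by auto
    with \<open>c < d\<close> show "0 \<le> pbar p c d"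
      using reciprocal_integral_pos[of c d] by (simp add: pbar_def)
  qed
qed (use assms in force)

end

section \<open>Variation is not quasi-additive at the point\<close>

theorem theorem2p13:
  fixes a b x :: real and p :: "real \<Rightarrow> real"
  assumes "a < b"
    and "\<And>y. y \<in> {a..b} \<Longrightarrow> 1 \<le> p y"
    and "set_integrable lebesgue {a..b} p"
    and "x \<in> {a<..<b}"
    and "pbar_inf p x a b < max (pbar_inf p x a x) (pbar_inf p x x b)"
  shows "\<forall>C::real. 1 \<le> C \<longrightarrow>
    (\<exists>f\<in>WBV p a b. Var p f a b > ennreal C * (Var p f a x + Var p f x b))"
proof (intro allI impI)
  fix C :: real assume "1 \<le> C"
  define M where "M = max (pbar_inf p x a x) (pbar_inf p x x b)"
  have "pbar p a b \<in> {pbar p c d | c d. c < d \<and> x \<in> {c..d} \<and> {c..d} \<subseteq> {a..b}}"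
    using assms(1,4) by force
  then have "{pbar p c d | c d. c < d \<and> x \<in> {c..d} \<and> {c..d} \<subseteq> {a..b}} \<noteq> {}"
    by blast
  from cInf_lessD[OF this, folded pbar_inf_def, OF assms(5)]
  obtain c0 d0 where "c0 < d0" "x \<in> {c0..d0}" "{c0..d0} \<subseteq> {a..b}" "pbar p c0 d0 < M"
    unfolding M_def by blast
  then obtain c d where cd: "a < c" "c < x" "x < d" "d < b" "pbar p c d < M"
    using pbar_less_strictly_inside[OF assms(2,3), of c0 d0 x M] assms(4) by auto
  have le: "pbar_inf p x \<alpha> \<beta> \<le> pbar p s t"
    if "a \<le> \<alpha>" "\<alpha> \<le> s" "s < t" "t \<le> \<beta>" "\<beta> \<le> b" "x \<in> {s..t}" for \<alpha> \<beta> s t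
    using pbar_inf_le[OF assms(2,3)] that by blast
  show "\<exists>f\<in>WBV p a b. Var p f a b > ennreal C * (Var p f a x + Var p f x b)"
  proof (cases "M = pbar_inf p x a x")
    case True
    show ?thesis
      by (rule ex_step_Var_gt[where U = "{x..}" and c = c and d = d and M = M])
        (use assms(4) cd \<open>1 \<le> C\<close> in \<open>auto simp: True intro!: le\<close>)
  next
    case False
    then have M: "M = pbar_inf p x x b" by (auto simp: M_def max_def split: if_splits)
    show ?thesis
      by (rule ex_step_Var_gt[where U = "{x<..}" and c = c and d = d and M = M])
        (use assms(4) cd \<open>1 \<le> C\<close> in \<open>auto simp: M intro!: le\<close>)
  qed
qed

end
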